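(* Let $(M^n,g)$, $n\ge2$, be the base manifold of a static perfect fluid spacetime $\tilde M=M\times_f\mathbb{R}$ with warping function $f>0$ and isotropic pressure $\rho$. Suppose $M$ admits a steady gradient Ricci soliton with potential function $f$, i.e. $H^f+S=0$ on $M$. If $(M,g)$ is Ricci symmetric ($\nabla S=0$) with constant scalar curvature $r$, then either the warping function $f$ is constant, or the fluid is a stiff matter fluid, i.e. $\rho=\frac r2$.
   Context: $(M^n,g)$ is a Riemannian manifold with Levi-Civita connection $\nabla$, $f>0$ a smooth function on $M$, and $\tilde M=M\times_f\mathbb{R}$ is $M\times\mathbb{R}$ with metric $\tilde g=g-f^2dt^2$. It is a static perfect fluid (SPF) spacetime with isotropic pressure $\rho$ (a smooth function) if, with $S$, $r$ the Ricci tensor and scalar curvature of $(M,g)$ and $H^f,\triangle f$ the Hessian and Laplacian (trace of the Hessian) of $f$ on $(M,g)$, $$f\Big(S-\frac rn g\Big)=H^f-\frac{\triangle f}{n}g,\qquad \triangle f=\Big(\frac{n-2}{2(n-1)}r+\frac{n}{n-1}\rho\Big)f .$$ A gradient Ricci soliton with potential function $f$ means $H^f+S+\lambda g=0$ with $\lambda$ constant; steady means $\lambda=0$. Stiff matter means that the energy density $\sigma$ equals the pressure $\rho$; since $\sigma=\frac r2$ for an SPF spacetime, this means $\rho=\frac r2$. *)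

theory Defs
  imports "HOL-Analysis.Analysis"
begin

text \<open>
  The libraries have no manifolds, so tensor calculus is done classically, in the charts of an
  atlas. Coordinate expressions are kept as functions of the point \<open>p\<close> of the manifold and only
  differentiated through the chart. A tensor field is a family of component functions indexed by
  the charts; an equation between tensor (or scalar) fields is required in every chart of the atlas
  at every point of its domain.
\<close>

subsection \<open>Smooth maps between Euclidean spaces\<close>

fun Ck_on :: "nat \<Rightarrow> 'v set \<Rightarrow> ('v::euclidean_space \<Rightarrow> 'w::real_normed_vector) \<Rightarrow> bool" where
  "Ck_on 0 U F \<longleftrightarrow> continuous_on U F"
| "Ck_on (Suc k) U F \<longleftrightarrow>
     (\<forall>x\<in>U. F differentiable at x) \<and> (\<forall>v. Ck_on k U (\<lambda>x. frechet_derivative F (at x) v))"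

text \<open>Only used for open \<open>U\<close>.\<close>

definition smooth_on :: "'v set \<Rightarrow> ('v::euclidean_space \<Rightarrow> 'w::real_normed_vector) \<Rightarrow> bool" where
  "smooth_on U F \<longleftrightarrow> (\<forall>k. Ck_on k U F)"


subsection \<open>Smooth manifolds\<close>

record ('a, 'n) chart =
  chart_dom :: "'a set"
  coord :: "'a \<Rightarrow> real ^ 'n"

definition chart_image :: "('a, 'n::finite) chart \<Rightarrow> (real ^ 'n) set" where
  "chart_image c = coord c ` chart_dom c"

definition chart_inv :: "('a, 'n::finite) chart \<Rightarrow> real ^ 'n \<Rightarrow> 'a" where
  "chart_inv c = inv_into (chart_dom c) (coord c)"

definition smooth_manifold :: "'a topology \<Rightarrow> ('a, 'n::finite) chart set \<Rightarrow> bool" where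
  "smooth_manifold M A \<longleftrightarrow>
     Hausdorff_space M \<and> second_countable M \<and>
     (\<Union>c\<in>A. chart_dom c) = topspace M \<and>
     (\<forall>c\<in>A. openin M (chart_dom c) \<and> open (chart_image c) \<and>
        homeomorphic_map (subtopology M (chart_dom c)) (top_of_set (chart_image c)) (coord c)) \<and>
     (\<forall>c\<in>A. \<forall>d\<in>A.
        smooth_on (coord c ` (chart_dom c \<inter> chart_dom d)) (coord d \<circ> chart_inv c))"

definition smooth_function :: "('a, 'n::finite) chart set \<Rightarrow> ('a \<Rightarrow> real) \<Rightarrow> bool" where
  "smooth_function A h \<longleftrightarrow> (\<forall>c\<in>A. smooth_on (chart_image c) (h \<circ> chart_inv c))"

text \<open>\<open>pd c i h p\<close> is the value at \<open>p\<close> of the derivative of \<open>h\<close> along the \<open>i\<close>-th coordinate vector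
  field of \<open>c\<close>.\<close>

definition pd :: "('a, 'n::finite) chart \<Rightarrow> 'n \<Rightarrow> ('a \<Rightarrow> real) \<Rightarrow> 'a \<Rightarrow> real" where
  "pd c i h p = frechet_derivative (h \<circ> chart_inv c) (at (coord c p)) (axis i 1)"


subsection \<open>Riemannian metrics and the Levi-Civita connection\<close>

text \<open>\<open>g c p\<close> is the Gram matrix at \<open>p\<close> of the coordinate frame of \<open>c\<close>.\<close>

type_synonym ('a, 'n) metric = "('a, 'n) chart \<Rightarrow> 'a \<Rightarrow> real ^ 'n ^ 'n"

definition riemannian_metric ::
    "('a, 'n::finite) chart set \<Rightarrow> ('a, 'n) metric \<Rightarrow> bool" where
  "riemannian_metric A g \<longleftrightarrow>
     (\<forall>c\<in>A. \<forall>i j. smooth_on (chart_image c) ((\<lambda>p. g c p $ i $ j) \<circ> chart_inv c)) \<and>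
     (\<forall>c\<in>A. \<forall>p\<in>chart_dom c.
        transpose (g c p) = g c p \<and> (\<forall>v. v \<noteq> 0 \<longrightarrow> v \<bullet> (g c p *v v) > 0)) \<and>
     (\<forall>c\<in>A. \<forall>d\<in>A. \<forall>p\<in>chart_dom c \<inter> chart_dom d. \<forall>i j.
        g d p $ i $ j =
          (\<Sum>a\<in>UNIV. \<Sum>b\<in>UNIV.
             pd d i (\<lambda>q. coord c q $ a) p * pd d j (\<lambda>q. coord c q $ b) p * g c p $ a $ b))"

definition riemannian_manifold ::
    "'a topology \<Rightarrow> ('a, 'n::finite) chart set \<Rightarrow> ('a, 'n) metric \<Rightarrow> bool" where
  "riemannian_manifold M A g \<longleftrightarrow> smooth_manifold M A \<and> riemannian_metric A g"

text \<open>\<open>christoffel g c k i j\<close> is the coefficient with upper index \<open>k\<close> and lower indices \<open>i\<close>, \<open>j\<close>.\<close>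

definition christoffel ::
    "('a, 'n::finite) metric \<Rightarrow> ('a, 'n) chart \<Rightarrow> 'n \<Rightarrow> 'n \<Rightarrow> 'n \<Rightarrow> 'a \<Rightarrow> real" where
  "christoffel g c k i j p =
     (\<Sum>l\<in>UNIV. matrix_inv (g c p) $ k $ l *
        (pd c i (\<lambda>q. g c q $ j $ l) p + pd c j (\<lambda>q. g c q $ i $ l) p
           - pd c l (\<lambda>q. g c q $ i $ j) p)) / 2"

text \<open>Covariant derivatives, along the \<open>i\<close>-th coordinate vector field, of tensor fields of type
  (0,1) and (0,2) given by their components in the chart \<open>c\<close>.\<close>

definition nabla1 ::
    "('a, 'n::finite) metric \<Rightarrow> ('a, 'n) chart \<Rightarrow> ('n \<Rightarrow> 'a \<Rightarrow> real) \<Rightarrow> 'n \<Rightarrow> 'n \<Rightarrow> 'a \<Rightarrow> real" where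
  "nabla1 g c w i j p = pd c i (w j) p - (\<Sum>k\<in>UNIV. christoffel g c k i j p * w k p)"

definition nabla2 ::
    "('a, 'n::finite) metric \<Rightarrow> ('a, 'n) chart \<Rightarrow> ('n \<Rightarrow> 'n \<Rightarrow> 'a \<Rightarrow> real) \<Rightarrow>
       'n \<Rightarrow> 'n \<Rightarrow> 'n \<Rightarrow> 'a \<Rightarrow> real" where
  "nabla2 g c T i j k p =
     pd c i (T j k) p - (\<Sum>l\<in>UNIV. christoffel g c l i j p * T l k p)
                      - (\<Sum>l\<in>UNIV. christoffel g c l i k p * T j l p)"


subsection \<open>Curvature, Hessian and Laplacian\<close>

text \<open>\<open>riemann g c l k i j\<close> is the \<open>l\<close>-th component of
  \<open>R(\<partial>\<^sub>i, \<partial>\<^sub>j)\<partial>\<^sub>k = \<nabla>\<^sub>i\<nabla>\<^sub>j\<partial>\<^sub>k - \<nabla>\<^sub>j\<nabla>\<^sub>i\<partial>\<^sub>k\<close>; the Ricci tensor is \<open>Ric(Y,Z) = tr (X \<mapsto> R(X,Y)Z)\<close>, positive on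
  round spheres.\<close>

definition riemann ::
    "('a, 'n::finite) metric \<Rightarrow> ('a, 'n) chart \<Rightarrow> 'n \<Rightarrow> 'n \<Rightarrow> 'n \<Rightarrow> 'n \<Rightarrow> 'a \<Rightarrow> real" where
  "riemann g c l k i j p =
     pd c i (christoffel g c l j k) p - pd c j (christoffel g c l i k) p
     + (\<Sum>m\<in>UNIV. christoffel g c l i m p * christoffel g c m j k p)
     - (\<Sum>m\<in>UNIV. christoffel g c l j m p * christoffel g c m i k p)"

definition ricci ::
    "('a, 'n::finite) metric \<Rightarrow> ('a, 'n) chart \<Rightarrow> 'n \<Rightarrow> 'n \<Rightarrow> 'a \<Rightarrow> real" where
  "ricci g c j k p = (\<Sum>i\<in>UNIV. riemann g c i k i j p)"

definition metric_trace ::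
    "('a, 'n::finite) metric \<Rightarrow> ('a, 'n) chart \<Rightarrow> ('n \<Rightarrow> 'n \<Rightarrow> 'a \<Rightarrow> real) \<Rightarrow> 'a \<Rightarrow> real" where
  "metric_trace g c T p = (\<Sum>i\<in>UNIV. \<Sum>j\<in>UNIV. matrix_inv (g c p) $ i $ j * T i j p)"

text \<open>\<open>scalar_curvature\<close> and \<open>laplacian\<close> are computed in a chart but do not depend on it.\<close>

definition scalar_curvature ::
    "('a, 'n::finite) metric \<Rightarrow> ('a, 'n) chart \<Rightarrow> 'a \<Rightarrow> real" where
  "scalar_curvature g c = metric_trace g c (ricci g c)"

definition hessian ::
    "('a, 'n::finite) metric \<Rightarrow> ('a, 'n) chart \<Rightarrow> ('a \<Rightarrow> real) \<Rightarrow> 'n \<Rightarrow> 'n \<Rightarrow> 'a \<Rightarrow> real" where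
  "hessian g c h = nabla1 g c (\<lambda>j. pd c j h)"

definition laplacian ::
    "('a, 'n::finite) metric \<Rightarrow> ('a, 'n) chart \<Rightarrow> ('a \<Rightarrow> real) \<Rightarrow> 'a \<Rightarrow> real" where
  "laplacian g c h = metric_trace g c (hessian g c h)"

definition ricci_symmetric ::
    "('a, 'n::finite) chart set \<Rightarrow> ('a, 'n) metric \<Rightarrow> bool" where
  "ricci_symmetric A g \<longleftrightarrow>
     (\<forall>c\<in>A. \<forall>p\<in>chart_dom c. \<forall>i j k. nabla2 g c (ricci g c) i j k p = 0)"

definition constant_scalar_curvature ::
    "('a, 'n::finite) chart set \<Rightarrow> ('a, 'n) metric \<Rightarrow> bool" where
  "constant_scalar_curvature A g \<longleftrightarrow>
     (\<exists>r0. \<forall>c\<in>A. \<forall>p\<in>chart_dom c. scalar_curvature g c p = r0)"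


subsection \<open>Static perfect fluids and gradient Ricci solitons\<close>

text \<open>The spacetime \<open>M \<times>\<^sub>f \<real>\<close> with the metric \<open>g - f\<^sup>2 dt\<^sup>2\<close> enters only through the following system
  on its base, which is the definition of a static perfect fluid with isotropic pressure \<open>rho\<close>.\<close>

definition static_perfect_fluid ::
    "('a, 'n::finite) chart set \<Rightarrow> ('a, 'n) metric \<Rightarrow> ('a \<Rightarrow> real) \<Rightarrow> ('a \<Rightarrow> real) \<Rightarrow> bool" where
  "static_perfect_fluid A g f rho \<longleftrightarrow>
     smooth_function A f \<and> smooth_function A rho \<and>
     (\<forall>c\<in>A. \<forall>p\<in>chart_dom c.
        let n = real CARD('n); r = scalar_curvature g c p in
          f p > 0 \<and>
          (\<forall>i j. f p * (ricci g c i j p - r / n * g c p $ i $ j)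
                   = hessian g c f i j p - laplacian g c f p / n * g c p $ i $ j) \<and>
          laplacian g c f p = ((n - 2) / (2 * (n - 1)) * r + n / (n - 1) * rho p) * f p)"

definition gradient_ricci_soliton ::
    "('a, 'n::finite) chart set \<Rightarrow> ('a, 'n) metric \<Rightarrow> ('a \<Rightarrow> real) \<Rightarrow> real \<Rightarrow> bool" where
  "gradient_ricci_soliton A g f lam \<longleftrightarrow>
     smooth_function A f \<and>
     (\<forall>c\<in>A. \<forall>p\<in>chart_dom c. \<forall>i j.
        hessian g c f i j p + ricci g c i j p + lam * g c p $ i $ j = 0)"

abbreviation steady_gradient_ricci_soliton ::
    "('a, 'n::finite) chart set \<Rightarrow> ('a, 'n) metric \<Rightarrow> ('a \<Rightarrow> real) \<Rightarrow> bool" where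
  "steady_gradient_ricci_soliton A g f \<equiv> gradient_ricci_soliton A g f 0"

text \<open>The energy density of a static perfect fluid is half the scalar curvature of the base.\<close>

definition stiff_matter ::
    "('a, 'n::finite) chart set \<Rightarrow> ('a, 'n) metric \<Rightarrow> ('a \<Rightarrow> real) \<Rightarrow> bool" where
  "stiff_matter A g rho \<longleftrightarrow>
     (\<forall>c\<in>A. \<forall>p\<in>chart_dom c. rho p = scalar_curvature g c p / 2)"


subsection \<open>The connection is torsion-free and metric\<close>

lemma pd_cong:
  assumes "smooth_manifold M A" "c \<in> A" "p \<in> chart_dom c"
    and "\<And>q. q \<in> chart_dom c \<Longrightarrow> h q = k q"
  shows "pd c i h p = pd c i k p"
proof -
  have op: "open (chart_image c)"
    using assms(1,2) by (auto simp: smooth_manifold_def)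
  have pin: "coord c p \<in> chart_image c"
    using assms(3) by (auto simp: chart_image_def)
  have eq: "(h \<circ> chart_inv c) x = (k \<circ> chart_inv c) x" if "x \<in> chart_image c" for x
    using that assms(4) by (simp add: chart_image_def chart_inv_def inv_into_into)
  have "((h \<circ> chart_inv c) has_derivative D) (at (coord c p)) \<longleftrightarrow>
        ((k \<circ> chart_inv c) has_derivative D) (at (coord c p))" for D
    using has_derivative_transform_within_open[OF _ op pin, of "h \<circ> chart_inv c" D UNIV "k \<circ> chart_inv c"]
      has_derivative_transform_within_open[OF _ op pin, of "k \<circ> chart_inv c" D UNIV "h \<circ> chart_inv c"] eq
    by auto
  then show ?thesis by (simp add: pd_def frechet_derivative_def)
qed

lemma metric_sym:
  assumes "riemannian_manifold M A g" "c \<in> A" "p \<in> chart_dom c"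
  shows "g c p $ i $ j = g c p $ j $ i"
proof -
  have "transpose (g c p) = g c p"
    using assms by (auto simp: riemannian_manifold_def riemannian_metric_def)
  then show ?thesis by (metis transpose_def vec_lambda_beta)
qed

lemma metric_inverse:
  assumes "riemannian_manifold M A g" "c \<in> A" "p \<in> chart_dom c"
  shows "g c p ** matrix_inv (g c p) = mat 1" "matrix_inv (g c p) ** g c p = mat 1"
proof -
  have pos: "v \<noteq> 0 \<Longrightarrow> v \<bullet> (g c p *v v) > 0" for v
    using assms by (auto simp: riemannian_manifold_def riemannian_metric_def)
  have "\<forall>v. g c p *v v = 0 \<longrightarrow> v = 0"
  proof (intro allI impI)
    fix v assume "g c p *v v = 0"
    then show "v = 0" using pos[of v] by (cases "v = 0") auto
  qed
  then have "invertible (g c p)"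
    using matrix_left_invertible_ker invertible_left_inverse by blast
  then show "g c p ** matrix_inv (g c p) = mat 1" "matrix_inv (g c p) ** g c p = mat 1"
    by (auto simp: invertible_def matrix_inv_def intro: someI2_ex)
qed

lemma christoffel_sym:
  assumes "riemannian_manifold M A g" "c \<in> A" "p \<in> chart_dom c"
  shows "christoffel g c k i j p = christoffel g c k j i p"
proof -
  have "smooth_manifold M A" using assms by (simp add: riemannian_manifold_def)
  then have "pd c l (\<lambda>q. g c q $ i $ j) p = pd c l (\<lambda>q. g c q $ j $ i) p" for l
    using metric_sym[OF assms(1,2)] assms by (intro pd_cong) auto
  then show ?thesis by (simp add: christoffel_def add.commute)
qed

lemma christoffel_lower:
  assumes "riemannian_manifold M A g" "c \<in> A" "p \<in> chart_dom c"
  shows "(\<Sum>l\<in>UNIV. christoffel g c l i j p * g c p $ l $ k) =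
    (pd c i (\<lambda>q. g c q $ j $ k) p + pd c j (\<lambda>q. g c q $ i $ k) p
       - pd c k (\<lambda>q. g c q $ i $ j) p) / 2"
proof -
  define B where "B m = (pd c i (\<lambda>q. g c q $ j $ m) p + pd c j (\<lambda>q. g c q $ i $ m) p
       - pd c m (\<lambda>q. g c q $ i $ j) p) / 2" for m
  have "(\<Sum>l\<in>UNIV. christoffel g c l i j p * g c p $ l $ k)
     = (\<Sum>l\<in>UNIV. \<Sum>m\<in>UNIV. g c p $ k $ l * matrix_inv (g c p) $ l $ m * B m)"
    using metric_sym[OF assms, of _ k]
    by (simp add: christoffel_def B_def sum_distrib_left sum_distrib_right sum_divide_distrib mult_ac)
  also have "\<dots> = (\<Sum>m\<in>UNIV. (g c p ** matrix_inv (g c p)) $ k $ m * B m)"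
    by (subst sum.swap) (simp add: matrix_matrix_mult_def sum_distrib_right)
  also have "\<dots> = (\<Sum>m\<in>UNIV. if m = k then B m else 0)"
    by (intro sum.cong) (auto simp: metric_inverse[OF assms] mat_def)
  also have "\<dots> = B k" by simp
  finally show ?thesis by (simp add: B_def)
qed

lemma nabla_metric:
  assumes "riemannian_manifold M A g" "c \<in> A" "p \<in> chart_dom c"
  shows "nabla2 g c (\<lambda>j k q. g c q $ j $ k) i j k p = 0"
proof -
  have "smooth_manifold M A" using assms by (simp add: riemannian_manifold_def)
  then have sw: "pd c l (\<lambda>q. g c q $ a $ b) p = pd c l (\<lambda>q. g c q $ b $ a) p" for l a b
    using metric_sym[OF assms(1,2)] assms by (intro pd_cong) auto
  have "(\<Sum>l\<in>UNIV. christoffel g c l i k p * g c p $ j $ l)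
      = (\<Sum>l\<in>UNIV. christoffel g c l i k p * g c p $ l $ j)"
    using metric_sym[OF assms, of j] by simp
  then show ?thesis
    using sw[of i j k] sw[of j i k] sw[of k i j]
    by (simp add: nabla2_def christoffel_lower[OF assms] field_simps)
qed

end

theory Submission
  imports Defs
begin

text \<open>
  The idea is to show that the scalar curvature \<open>r\<close> vanishes; the fluid is then stiff at once.

  The soliton equation replaces the Hessian of \<open>f\<close> by \<open>-S\<close>, and taking traces gives
  \<open>\<triangle>f = -r\<close>. The tracefree part of the fluid system becomes \<open>(f + 1)(S - (r/n) g) = 0\<close>, and
  \<open>f > 0\<close> makes \<open>(M, g)\<close> Einstein: \<open>S = (r/n) g\<close>, so that the Hessian of \<open>f\<close> is \<open>\<kappa> g\<close> with the
  constant \<open>\<kappa> = -r/n\<close> (\<open>spf_soliton_einstein\<close>).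

  In terms of the gradient field \<open>X\<close> of \<open>f\<close> this says \<open>\<nabla>X = \<kappa> id\<close>. As \<open>\<kappa>\<close> is constant, the
  second covariant derivative of \<open>X\<close> vanishes, so the Ricci identity gives \<open>R(Y,Z)X = 0\<close> for all
  \<open>Y\<close>, \<open>Z\<close>, and its trace is \<open>S(Z,X) = 0\<close> (\<open>concircular_ricci\<close>). By the Einstein equation this is
  \<open>(r/n) df = 0\<close>. If \<open>r\<close> were not zero, \<open>df\<close> would vanish on a whole chart, hence also the Hessian
  and \<open>\<triangle>f = -r\<close>, a contradiction (\<open>spf_soliton_scalar_curvature_0\<close>). So \<open>r = 0\<close> and
  \<open>\<triangle>f = 0\<close>, and the second fluid equation reduces to \<open>\<rho> = 0 = r/2\<close>.

  The Ricci identity for \<open>X\<close> rests on the symmetry of second partial derivatives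
  (\<open>second_derivative_symmetric\<close>) and on the differentiability of the inverse metric, through
  which both \<open>X\<close> and the Christoffel symbols are defined (\<open>differentiable_matrix_inv\<close>).
\<close>

section \<open>Symmetry of second derivatives\<close>

text \<open>The second difference of \<open>F\<close> over the parallelogram spanned by \<open>s u\<close> and \<open>s v\<close> is \<open>s\<close> times a
  difference of derivatives in direction \<open>u\<close> at two points that differ by \<open>s v\<close> (mean value
  theorem along \<open>u\<close>). Expanding that derivative to first order at \<open>x\<close> gives \<open>s\<^sup>2 H v + o(s\<^sup>2)\<close>, where
  \<open>H\<close> is the derivative of \<open>F' _ u\<close>.\<close>

lemma second_difference_limit:
  fixes F :: "'v::real_normed_vector \<Rightarrow> real"
  assumes U: "open U" "x \<in> U"
    and F: "\<And>y. y \<in> U \<Longrightarrow> (F has_derivative F' y) (at y)"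
    and H: "((\<lambda>y. F' y u) has_derivative H) (at x)"
    and e: "e > 0"
  shows "\<exists>d>0. \<forall>s. 0 < s \<and> s < d \<longrightarrow>
    \<bar>F (x + s *\<^sub>R u + s *\<^sub>R v) - F (x + s *\<^sub>R u) - F (x + s *\<^sub>R v) + F x - s\<^sup>2 * H v\<bar> \<le> e * s\<^sup>2"
proof -
  define N where "N = norm u + norm v + 1"
  have N: "N > 0" by (simp add: N_def add_nonneg_pos)
  \<comment> \<open>The remainder enters at both ends of the side \<open>s v\<close>, each time at most \<open>e' s N\<close>.\<close>
  define e' where "e' = e / (2 * N)"
  have e': "e' > 0" using e N by (simp add: e'_def)
  obtain d0 where d0: "d0 > 0" "ball x d0 \<subseteq> U"
    using U open_contains_ball by blast
  obtain d1 where d1: "d1 > 0"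
    "\<And>y. norm (y - x) < d1 \<Longrightarrow> norm (F' y u - F' x u - H (y - x)) \<le> e' * norm (y - x)"
    using H e' unfolding has_derivative_at_alt by blast
  have linH: "linear H" using H has_derivative_linear by blast
  define d where "d = min d0 d1 / N"
  have "d > 0" using d0 d1 N by (simp add: d_def)
  moreover
  have "\<bar>F (x + s *\<^sub>R u + s *\<^sub>R v) - F (x + s *\<^sub>R u) - F (x + s *\<^sub>R v) + F x - s\<^sup>2 * H v\<bar> \<le> e * s\<^sup>2"
    if s: "0 < s" "s < d" for s
  proof -
    have sN: "s * N < d0" "s * N < d1" using s N by (auto simp: d_def field_simps)
    have bound: "norm (t *\<^sub>R u + r *\<^sub>R v) \<le> s * N" if "0 \<le> t" "t \<le> s" "0 \<le> r" "r \<le> s" for t r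
    proof -
      have "norm (t *\<^sub>R u + r *\<^sub>R v) \<le> t * norm u + r * norm v"
        using norm_triangle_ineq[of "t *\<^sub>R u" "r *\<^sub>R v"] that by simp
      also have "\<dots> \<le> s * norm u + s * norm v"
        using that by (intro add_mono mult_right_mono) auto
      also have "\<dots> \<le> s * N" using s by (simp add: N_def algebra_simps)
      finally show ?thesis .
    qed
    have inU: "x + (t *\<^sub>R u + r *\<^sub>R v) \<in> U" if "0 \<le> t" "t \<le> s" "0 \<le> r" "r \<le> s" for t r
    proof -
      have "dist x (x + (t *\<^sub>R u + r *\<^sub>R v)) = norm (t *\<^sub>R u + r *\<^sub>R v)"
        by (metis add_diff_cancel_left' dist_commute dist_norm)
      then have "x + (t *\<^sub>R u + r *\<^sub>R v) \<in> ball x d0"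
        using bound[OF that] sN(1) by simp
      then show ?thesis using d0(2) by blast
    qed
    have rem: "\<bar>F' (x + (t *\<^sub>R u + r *\<^sub>R v)) u - F' x u - H (t *\<^sub>R u + r *\<^sub>R v)\<bar> \<le> e' * (s * N)"
      if "0 \<le> t" "t \<le> s" "0 \<le> r" "r \<le> s" for t r
    proof -
      have "norm (F' (x + (t *\<^sub>R u + r *\<^sub>R v)) u - F' x u - H (t *\<^sub>R u + r *\<^sub>R v))
          \<le> e' * norm (t *\<^sub>R u + r *\<^sub>R v)"
        using d1(2)[of "x + (t *\<^sub>R u + r *\<^sub>R v)"] bound[OF that] sN by simp
      also have "\<dots> \<le> e' * (s * N)" using bound[OF that] e' by (intro mult_left_mono) auto
      finally show ?thesis by simp
    qed
    \<comment> \<open>The increment of \<open>F\<close> along \<open>s v\<close>; the term \<open>0 *\<^sub>R v\<close> makes both ends instances of \<open>DF\<close> and \<open>rem\<close>.\<close>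
    define G where "G t = F (x + (t *\<^sub>R u + s *\<^sub>R v)) - F (x + (t *\<^sub>R u + 0 *\<^sub>R v))" for t
    have DF: "((\<lambda>t. F (x + (t *\<^sub>R u + r *\<^sub>R v))) has_derivative
          (\<lambda>h. F' (x + (t *\<^sub>R u + r *\<^sub>R v)) (h *\<^sub>R u))) (at t within {0..s})"
      if "0 \<le> t" "t \<le> s" "0 \<le> r" "r \<le> s" for t r
      by (rule has_derivative_compose[where f = "\<lambda>t. x + (t *\<^sub>R u + r *\<^sub>R v)", OF _ F[OF inU[OF that]]]) (auto intro!: derivative_eq_intros)
    have "\<exists>z\<in>{0<..<s}. G s - G 0 = (\<lambda>h. F' (x + (z *\<^sub>R u + s *\<^sub>R v)) (h *\<^sub>R u)
         - F' (x + (z *\<^sub>R u + 0 *\<^sub>R v)) (h *\<^sub>R u)) (s - 0)"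
      unfolding G_def using s DF by (intro mvt_simple has_derivative_diff DF) simp_all
    then obtain z where z: "0 < z" "z < s" and
      G: "G s - G 0 = F' (x + (z *\<^sub>R u + s *\<^sub>R v)) (s *\<^sub>R u) - F' (x + (z *\<^sub>R u + 0 *\<^sub>R v)) (s *\<^sub>R u)"
      by auto
    define a b where "a = F' (x + (z *\<^sub>R u + s *\<^sub>R v)) u" and "b = F' (x + (z *\<^sub>R u + 0 *\<^sub>R v)) u"
    have lin: "linear (F' (x + (z *\<^sub>R u + r *\<^sub>R v)))" if "0 \<le> r" "r \<le> s" for r
      by (rule has_derivative_linear[OF F[OF inU]]) (use z that in simp_all)
    have G': "G s - G 0 = s * (a - b)"
      unfolding G a_def b_def using s lin[of s] lin[of 0]
      by (simp only: linear_cmul order_refl less_imp_le real_scaleR_def right_diff_distrib)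
    have "\<bar>a - F' x u - H (z *\<^sub>R u + s *\<^sub>R v)\<bar> \<le> e' * (s * N)"
      "\<bar>b - F' x u - H (z *\<^sub>R u + 0 *\<^sub>R v)\<bar> \<le> e' * (s * N)"
      unfolding a_def b_def using z s by (intro rem; simp)+
    then have ab: "\<bar>a - b - s * H v\<bar> \<le> 2 * (e' * (s * N))"
      using linH by (simp add: linear_add linear_cmul)
    have "F (x + s *\<^sub>R u + s *\<^sub>R v) - F (x + s *\<^sub>R u) - F (x + s *\<^sub>R v) + F x - s\<^sup>2 * H v
        = s * (a - b - s * H v)"
      using G' by (simp add: G_def algebra_simps power2_eq_square)
    then have "\<bar>F (x + s *\<^sub>R u + s *\<^sub>R v) - F (x + s *\<^sub>R u) - F (x + s *\<^sub>R v) + F x - s\<^sup>2 * H v\<bar>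
        = s * \<bar>a - b - s * H v\<bar>"
      using s by (simp add: abs_mult)
    also have "\<dots> \<le> s * (2 * (e' * (s * N)))" using ab s by (intro mult_left_mono) auto
    also have "\<dots> = e * s\<^sup>2" using N by (simp add: e'_def power2_eq_square field_simps)
    finally show ?thesis .
  qed
  ultimately show ?thesis by blast
qed

text \<open>The second difference is symmetric in \<open>u\<close> and \<open>v\<close>, so its two expansions have the same leading
  coefficient.\<close>

lemma second_derivative_symmetric:
  fixes F :: "'v::real_normed_vector \<Rightarrow> real"
  assumes U: "open U" "x \<in> U"
    and F: "\<And>y. y \<in> U \<Longrightarrow> (F has_derivative F' y) (at y)"
    and Hu: "((\<lambda>y. F' y u) has_derivative Hu) (at x)"
    and Hv: "((\<lambda>y. F' y v) has_derivative Hv) (at x)"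
  shows "Hu v = Hv u"
proof -
  have "\<bar>Hu v - Hv u\<bar> \<le> 0 + e" if "e > 0" for e
  proof -
    have e: "e / 2 > 0" using that by simp
    define D where
      "D s = F (x + s *\<^sub>R u + s *\<^sub>R v) - F (x + s *\<^sub>R u) - F (x + s *\<^sub>R v) + F x" for s
    obtain d1 where d1: "d1 > 0" "\<And>s. 0 < s \<Longrightarrow> s < d1 \<Longrightarrow> \<bar>D s - s\<^sup>2 * Hu v\<bar> \<le> e / 2 * s\<^sup>2"
      using second_difference_limit[OF U F Hu e, of v] unfolding D_def by auto
    obtain d2 where d2: "d2 > 0" "\<And>s. 0 < s \<Longrightarrow> s < d2 \<Longrightarrow> \<bar>D s - s\<^sup>2 * Hv u\<bar> \<le> e / 2 * s\<^sup>2"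
      using second_difference_limit[OF U F Hv e, of u] unfolding D_def by (auto simp: algebra_simps)
    define s where "s = min d1 d2 / 2"
    have s: "0 < s" "s < d1" "s < d2" using d1 d2 by (auto simp: s_def min_def)
    have "\<bar>s\<^sup>2 * Hu v - s\<^sup>2 * Hv u\<bar> \<le> e * s\<^sup>2"
      using d1(2)[OF s(1,2)] d2(2)[OF s(1,3)] by linarith
    moreover have "\<bar>s\<^sup>2 * Hu v - s\<^sup>2 * Hv u\<bar> = s\<^sup>2 * \<bar>Hu v - Hv u\<bar>"
      unfolding right_diff_distrib[symmetric] abs_mult by simp
    ultimately have "s\<^sup>2 * \<bar>Hu v - Hv u\<bar> \<le> s\<^sup>2 * e" by (simp add: mult.commute)
    then show ?thesis using s by simp
  qed
  then have "\<bar>Hu v - Hv u\<bar> \<le> 0" by (rule field_le_epsilon)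
  then show ?thesis by simp
qed

section \<open>Differentiability of the inverse matrix\<close>

lemma differentiable_prod:
  fixes f :: "'i \<Rightarrow> 'v::real_normed_vector \<Rightarrow> real"
  assumes "\<And>i. i \<in> I \<Longrightarrow> f i differentiable at x"
  shows "(\<lambda>x. \<Prod>i\<in>I. f i x) differentiable at x"
  using has_derivative_prod[of I f _ x UNIV] assms unfolding differentiable_def by metis

lemma differentiable_det:
  fixes A :: "'v::real_normed_vector \<Rightarrow> real ^ 'n::finite ^ 'n"
  assumes "\<And>i j. (\<lambda>x. A x $ i $ j) differentiable at x"
  shows "(\<lambda>x. det (A x)) differentiable at x"
  unfolding det_def using assms
  by (intro differentiable_sum differentiable_mult differentiable_const differentiable_prod ballI)
     (auto simp: finite_permutations)

text \<open>Cramer's rule for the \<open>l\<close>-th column of the inverse. It exhibits each entry as a quotient of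
  polynomials in the entries of \<open>A\<close>, which makes differentiability evident.\<close>

lemma matrix_inv_entry:
  fixes A :: "real ^ 'n::finite ^ 'n"
  assumes "det A \<noteq> 0"
  shows "matrix_inv A $ k $ l = det (\<chi> i j. if j = k then axis l 1 $ i else A $ i $ j) / det A"
proof -
  have "A ** matrix_inv A = mat 1"
    using assms unfolding invertible_det_nz[symmetric] invertible_def matrix_inv_def
    by (rule someI2_ex) simp
  then have "A *v (matrix_inv A *v axis l 1) = axis l 1"
    by (simp add: matrix_vector_mul_assoc)
  then have "(matrix_inv A *v axis l 1) $ k
      = det (\<chi> i j. if j = k then axis l 1 $ i else A $ i $ j) / det A"
    unfolding cramer[OF assms] by simp
  then show ?thesis by (simp add: matrix_vector_mul_component inner_axis)
qed

lemma differentiable_matrix_inv: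
  fixes A :: "'v::real_normed_vector \<Rightarrow> real ^ 'n::finite ^ 'n"
  assumes A: "\<And>i j. (\<lambda>x. A x $ i $ j) differentiable at x"
    and U: "open U" "x \<in> U" "\<And>y. y \<in> U \<Longrightarrow> det (A y) \<noteq> 0"
  shows "(\<lambda>x. matrix_inv (A x) $ k $ l) differentiable at x"
proof -
  have "(\<lambda>y. det (\<chi> i j. if j = k then axis l 1 $ i else A y $ i $ j)) differentiable at x"
  proof (rule differentiable_det)
    fix i j show "(\<lambda>y. (\<chi> i j. if j = k then axis l 1 $ i else A y $ i $ j) $ i $ j) differentiable at x"
      by (cases "j = k") (simp_all add: A)
  qed
  then have "(\<lambda>y. det (\<chi> i j. if j = k then axis l 1 $ i else A y $ i $ j) / det (A y))
      differentiable at x"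
    using U by (intro differentiable_divide[OF _ differentiable_det[OF A]])
  then obtain D where "((\<lambda>y. det (\<chi> i j. if j = k then axis l 1 $ i else A y $ i $ j) / det (A y))
      has_derivative D) (at x)" by (auto simp: differentiable_def)
  then have "((\<lambda>y. matrix_inv (A y) $ k $ l) has_derivative D) (at x)"
    by (rule has_derivative_transform_within_open[OF _ U(1,2)]) (simp add: matrix_inv_entry U(3))
  then show ?thesis by (auto simp: differentiable_def)
qed

section \<open>Calculus in a chart\<close>

text \<open>\<open>pd\<close> is given by \<open>frechet_derivative\<close> and carries information only where the coordinate expression is
  differentiable. For functions with this property the usual rules of calculus hold for \<open>pd\<close>.\<close>

definition chart_differentiable :: "('a, 'n::finite) chart \<Rightarrow> ('a \<Rightarrow> real) \<Rightarrow> bool" where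
  "chart_differentiable c h \<longleftrightarrow> (\<forall>p\<in>chart_dom c. (h \<circ> chart_inv c) differentiable at (coord c p))"

locale manifold_chart =
  fixes M :: "'a topology" and A :: "('a, 'n::finite) chart set" and c :: "('a, 'n) chart"
  assumes manifold: "smooth_manifold M A" and chart: "c \<in> A"
begin

lemma open_image: "open (chart_image c)"
  using manifold chart by (auto simp: smooth_manifold_def)

lemma coord_image: "p \<in> chart_dom c \<Longrightarrow> coord c p \<in> chart_image c"
  by (simp add: chart_image_def)

lemma chart_inv_coord:
  assumes "p \<in> chart_dom c" shows "chart_inv c (coord c p) = p"
proof -
  have h: "homeomorphic_map (subtopology M (chart_dom c)) (top_of_set (chart_image c)) (coord c)"
    "openin M (chart_dom c)"
    using manifold chart by (auto simp: smooth_manifold_def)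
  then have "inj_on (coord c) (chart_dom c)"
    using homeomorphic_imp_injective_map openin_subset[OF h(2)] by (fastforce simp: topspace_subtopology Int_absorb1)
  then show ?thesis using assms by (simp add: chart_inv_def)
qed

lemma chart_inv_dom: "x \<in> chart_image c \<Longrightarrow> chart_inv c x \<in> chart_dom c"
  and coord_chart_inv: "x \<in> chart_image c \<Longrightarrow> coord c (chart_inv c x) = x"
  by (auto simp: chart_image_def chart_inv_def inv_into_into f_inv_into_f)

lemma pd_eqI:
  assumes "((h \<circ> chart_inv c) has_derivative D) (at (coord c p))"
  shows "pd c i h p = D (axis i 1)"
  using frechet_derivative_at[OF assms] by (simp add: pd_def)

lemma chart_has_derivative:
  assumes "chart_differentiable c h" "p \<in> chart_dom c"
  shows "((\<lambda>x. h (chart_inv c x)) has_derivative frechet_derivative (h \<circ> chart_inv c) (at (coord c p)))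
    (at (coord c p))"
  using assms by (simp add: chart_differentiable_def frechet_derivative_works o_def)

lemma chart_differentiable_const: "chart_differentiable c (\<lambda>q. k)"
  by (simp add: chart_differentiable_def o_def)

lemma chart_differentiable_add:
  "chart_differentiable c h \<Longrightarrow> chart_differentiable c k \<Longrightarrow> chart_differentiable c (\<lambda>q. h q + k q)"
  by (simp add: chart_differentiable_def o_def)

lemma chart_differentiable_diff:
  "chart_differentiable c h \<Longrightarrow> chart_differentiable c k \<Longrightarrow> chart_differentiable c (\<lambda>q. h q - k q)"
  by (simp add: chart_differentiable_def o_def)

lemma chart_differentiable_mult:
  "chart_differentiable c h \<Longrightarrow> chart_differentiable c k \<Longrightarrow> chart_differentiable c (\<lambda>q. h q * k q)"
  by (simp add: chart_differentiable_def o_def)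

lemma chart_differentiable_sum:
  fixes h :: "'i::finite \<Rightarrow> _"
  shows "(\<And>i. chart_differentiable c (h i)) \<Longrightarrow> chart_differentiable c (\<lambda>q. \<Sum>i\<in>UNIV. h i q)"
  by (simp add: chart_differentiable_def o_def)

lemma chart_differentiable_cong:
  assumes "\<And>q. q \<in> chart_dom c \<Longrightarrow> h q = k q" "chart_differentiable c h"
  shows "chart_differentiable c k"
  unfolding chart_differentiable_def
proof
  fix p assume p: "p \<in> chart_dom c"
  have "((\<lambda>x. k (chart_inv c x)) has_derivative frechet_derivative (h \<circ> chart_inv c) (at (coord c p)))
    (at (coord c p))"
    by (rule has_derivative_transform_within_open[OF chart_has_derivative[OF assms(2) p] open_image coord_image[OF p]])
       (simp add: assms(1) chart_inv_dom)
  then show "(k \<circ> chart_inv c) differentiable at (coord c p)"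
    by (auto simp: differentiable_def o_def)
qed

lemma pd_const: "pd c i (\<lambda>q. k) p = 0"
  by (simp add: pd_def o_def)

lemma pd_diff:
  assumes "chart_differentiable c h" "chart_differentiable c k" "p \<in> chart_dom c"
  shows "pd c i (\<lambda>q. h q - k q) p = pd c i h p - pd c i k p"
  using pd_eqI[of "\<lambda>q. h q - k q", unfolded o_def,
      OF has_derivative_diff[OF chart_has_derivative[OF assms(1,3)] chart_has_derivative[OF assms(2,3)]]]
  by (simp add: pd_def o_def)

lemma pd_mult:
  assumes "chart_differentiable c h" "chart_differentiable c k" "p \<in> chart_dom c"
  shows "pd c i (\<lambda>q. h q * k q) p = h p * pd c i k p + pd c i h p * k p"
  using pd_eqI[of "\<lambda>q. h q * k q", unfolded o_def,
      OF has_derivative_mult[OF chart_has_derivative[OF assms(1,3)] chart_has_derivative[OF assms(2,3)]]]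
  by (simp add: pd_def o_def chart_inv_coord assms)

lemma pd_sum:
  fixes h :: "'i::finite \<Rightarrow> _"
  assumes "\<And>j. chart_differentiable c (h j)" "p \<in> chart_dom c"
  shows "pd c i (\<lambda>q. \<Sum>j\<in>UNIV. h j q) p = (\<Sum>j\<in>UNIV. pd c i (h j) p)"
  using pd_eqI[of "\<lambda>q. \<Sum>j\<in>UNIV. h j q", unfolded o_def,
      OF has_derivative_sum[OF chart_has_derivative[OF assms(1,2)]]]
  by (simp add: pd_def o_def)

lemma pd_commute:
  assumes h: "chart_differentiable c h" "\<And>i. chart_differentiable c (pd c i h)" and p: "p \<in> chart_dom c"
  shows "pd c i (pd c j h) p = pd c j (pd c i h) p"
proof -
  let ?F = "h \<circ> chart_inv c" and ?x = "coord c p"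
  have F: "(?F has_derivative frechet_derivative ?F (at y)) (at y)" if "y \<in> chart_image c" for y
    using chart_has_derivative[OF h(1) chart_inv_dom[OF that]] coord_chart_inv[OF that]
    by (simp add: o_def)
  have second: "((\<lambda>y. frechet_derivative ?F (at y) (axis l 1)) has_derivative
      frechet_derivative (pd c l h \<circ> chart_inv c) (at ?x)) (at ?x)" for l
    by (rule has_derivative_transform_within_open[OF chart_has_derivative[OF h(2) p] open_image coord_image[OF p]])
       (simp add: pd_def coord_chart_inv)
  show ?thesis
    using second_derivative_symmetric[OF open_image coord_image[OF p] F second second]
    by (simp add: pd_def[of c _ "pd c _ h"])
qed

text \<open>Two orders of differentiability are all that the curvature computations need: the metric is
  differentiated once in the Christoffel symbols and once more in the Riemann tensor.\<close>

lemma smooth_imp_chart_differentiable: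
  assumes "smooth_on (chart_image c) (h \<circ> chart_inv c)"
  shows "chart_differentiable c h" "chart_differentiable c (pd c i h)"
proof -
  have "Ck_on (Suc (Suc 0)) (chart_image c) (h \<circ> chart_inv c)"
    using assms unfolding smooth_on_def by blast
  then have 1: "\<forall>x\<in>chart_image c. (h \<circ> chart_inv c) differentiable at x"
    and 2: "\<forall>x\<in>chart_image c. (\<lambda>x. frechet_derivative (h \<circ> chart_inv c) (at x) (axis i 1)) differentiable at x"
    by auto
  show "chart_differentiable c h"
    using 1 coord_image by (auto simp: chart_differentiable_def)
  show "chart_differentiable c (pd c i h)"
    unfolding chart_differentiable_def
  proof
    fix p assume p: "p \<in> chart_dom c"
    then obtain D where "((\<lambda>x. frechet_derivative (h \<circ> chart_inv c) (at x) (axis i 1)) has_derivative D)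
        (at (coord c p))"
      using 2 coord_image by (auto simp: differentiable_def)
    then have "((\<lambda>x. pd c i h (chart_inv c x)) has_derivative D) (at (coord c p))"
      by (rule has_derivative_transform_within_open[OF _ open_image coord_image[OF p]])
         (simp add: pd_def coord_chart_inv)
    then show "(pd c i h \<circ> chart_inv c) differentiable at (coord c p)"
      by (auto simp: differentiable_def o_def)
  qed
qed

end

section \<open>Concircular vector fields and the Ricci tensor\<close>

text \<open>Let \<open>\<nabla>X = \<kappa> id\<close> with \<open>\<kappa>\<close> constant. Then
  \<open>\<nabla>\<^sub>Y\<nabla>\<^sub>Z X - \<nabla>\<^sub>Z\<nabla>\<^sub>Y X - \<nabla>\<^bsub>[Y,Z]\<^esub> X = \<kappa> (\<nabla>\<^sub>Y Z - \<nabla>\<^sub>Z Y - [Y,Z]) = 0\<close> because the connection is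
  torsion-free, so the curvature annihilates \<open>X\<close>. In coordinates, the equation expresses the
  partial derivatives of \<open>X\<close> through \<open>X\<close> itself, hence \<open>X\<close> is twice differentiable and the
  integrability condition \<open>\<partial>\<^sub>i\<partial>\<^sub>j X = \<partial>\<^sub>j\<partial>\<^sub>i X\<close> is \<open>R(\<partial>\<^sub>i,\<partial>\<^sub>j)X = 0\<close>.\<close>

lemma concircular_ricci:
  fixes g :: "('a, 'n::finite) metric"
  assumes "manifold_chart M A c"
    and X: "\<And>k. chart_differentiable c (X k)"
    and christoffel: "\<And>k i j. chart_differentiable c (christoffel g c k i j)"
    and christoffel_sym: "\<And>k i j p. p \<in> chart_dom c \<Longrightarrow>
      christoffel g c k i j p = christoffel g c k j i p"
    and nabla: "\<And>i k p. p \<in> chart_dom c \<Longrightarrow>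
      pd c i (X k) p + (\<Sum>m\<in>UNIV. christoffel g c k i m p * X m p) = (if i = k then \<kappa> else 0)"
    and p: "p \<in> chart_dom c"
  shows "(\<Sum>k\<in>UNIV. ricci g c j k p * X k p) = 0"
proof -
  interpret manifold_chart M A c by fact
  let ?G = "christoffel g c"
  have dX: "pd c i (X k) q = (if i = k then \<kappa> else 0) - (\<Sum>m\<in>UNIV. ?G k i m q * X m q)"
    if "q \<in> chart_dom c" for i k q
    using nabla[OF that, of i k] by linarith
  have GX: "chart_differentiable c (\<lambda>q. ?G k i m q * X m q)" for k i m
    by (intro chart_differentiable_mult X christoffel)
  have pdX: "chart_differentiable c (pd c i (X k))" for i k
  proof (rule chart_differentiable_cong)
    show "(if i = k then \<kappa> else 0) - (\<Sum>m\<in>UNIV. ?G k i m q * X m q) = pd c i (X k) q"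
      if "q \<in> chart_dom c" for q using dX[OF that] by simp
    show "chart_differentiable c (\<lambda>q. (if i = k then \<kappa> else 0) - (\<Sum>m\<in>UNIV. ?G k i m q * X m q))"
      by (intro chart_differentiable_diff chart_differentiable_const chart_differentiable_sum GX)
  qed
  \<comment> \<open>Differentiate \<open>dX\<close> and substitute \<open>dX\<close> for the first derivatives that appear.\<close>
  have ddX: "pd c i (pd c j (X l)) p = - (\<Sum>k\<in>UNIV. pd c i (?G l j k) p * X k p)
      - \<kappa> * ?G l j i p + (\<Sum>k\<in>UNIV. (\<Sum>m\<in>UNIV. ?G l j m p * ?G m i k p) * X k p)" for i j l
  proof -
    have "pd c i (pd c j (X l)) p
        = pd c i (\<lambda>q. (if j = l then \<kappa> else 0) - (\<Sum>m\<in>UNIV. ?G l j m q * X m q)) p"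
      by (rule pd_cong[OF manifold chart p dX])
    also have "\<dots> = - (\<Sum>m\<in>UNIV. ?G l j m p * pd c i (X m) p + pd c i (?G l j m) p * X m p)"
      by (simp only: pd_diff[OF chart_differentiable_const chart_differentiable_sum[OF GX] p]
          pd_sum[OF GX p] pd_const pd_mult[OF christoffel X p] diff_0)
    also have "\<dots> = - (\<Sum>m\<in>UNIV. (if i = m then \<kappa> * ?G l j m p else 0)
          - (\<Sum>k\<in>UNIV. ?G l j m p * ?G m i k p * X k p) + pd c i (?G l j m) p * X m p)"
      by (rule arg_cong[where f = uminus], rule sum.cong)
         (simp_all add: dX[OF p] right_diff_distrib sum_distrib_left mult_ac)
    also have "\<dots> = - (\<Sum>k\<in>UNIV. pd c i (?G l j k) p * X k p) - \<kappa> * ?G l j i p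
        + (\<Sum>m\<in>UNIV. \<Sum>k\<in>UNIV. ?G l j m p * ?G m i k p * X k p)"
      by (simp add: sum.distrib sum_subtractf)
    also have "(\<Sum>m\<in>UNIV. \<Sum>k\<in>UNIV. ?G l j m p * ?G m i k p * X k p)
        = (\<Sum>k\<in>UNIV. (\<Sum>m\<in>UNIV. ?G l j m p * ?G m i k p) * X k p)"
      by (subst sum.swap) (simp add: sum_distrib_right)
    finally show ?thesis .
  qed
  have riemann: "(\<Sum>k\<in>UNIV. riemann g c l k i j p * X k p) = 0" for l i j
  proof -
    have "(\<Sum>k\<in>UNIV. riemann g c l k i j p * X k p)
        = (\<Sum>k\<in>UNIV. pd c i (?G l j k) p * X k p) - (\<Sum>k\<in>UNIV. pd c j (?G l i k) p * X k p)
        + (\<Sum>k\<in>UNIV. (\<Sum>m\<in>UNIV. ?G l i m p * ?G m j k p) * X k p)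
        - (\<Sum>k\<in>UNIV. (\<Sum>m\<in>UNIV. ?G l j m p * ?G m i k p) * X k p)"
      by (simp add: riemann_def sum.distrib sum_subtractf algebra_simps)
    also have "\<dots> = pd c j (pd c i (X l)) p - pd c i (pd c j (X l)) p"
      unfolding ddX using christoffel_sym[OF p, of l i j] by simp
    also have "\<dots> = 0" using pd_commute[OF X pdX p] by simp
    finally show ?thesis .
  qed
  \<comment> \<open>The Ricci tensor is the trace \<open>l = i\<close> of the Riemann tensor.\<close>
  have "(\<Sum>k\<in>UNIV. ricci g c j k p * X k p)
      = (\<Sum>i\<in>UNIV. \<Sum>k\<in>UNIV. riemann g c i k i j p * X k p)"
    by (subst sum.swap) (simp add: ricci_def sum_distrib_right)
  then show ?thesis by (simp add: riemann)
qed

section \<open>Gradients in a Riemannian chart\<close>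

locale riemannian_chart =
  fixes M :: "'a topology" and A :: "('a, 'n::finite) chart set"
    and g :: "('a, 'n) metric" and c :: "('a, 'n) chart"
  assumes riemannian: "riemannian_manifold M A g" and chart: "c \<in> A"
begin

sublocale manifold_chart M A c
  using riemannian chart by unfold_locales (auto simp: riemannian_manifold_def)

lemma metric_differentiable:
  "chart_differentiable c (\<lambda>q. g c q $ i $ j)" "chart_differentiable c (pd c k (\<lambda>q. g c q $ i $ j))"
  using riemannian chart
  by (auto simp: riemannian_manifold_def riemannian_metric_def intro!: smooth_imp_chart_differentiable)

lemma inverse_metric_differentiable: "chart_differentiable c (\<lambda>q. matrix_inv (g c q) $ k $ l)"
  unfolding chart_differentiable_def o_def
proof
  fix p assume p: "p \<in> chart_dom c"
  show "(\<lambda>x. matrix_inv (g c (chart_inv c x)) $ k $ l) differentiable at (coord c p)"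
  proof (rule differentiable_matrix_inv[OF _ open_image coord_image[OF p]])
    show "(\<lambda>x. g c (chart_inv c x) $ i $ j) differentiable at (coord c p)" for i j
      using metric_differentiable(1) p by (auto simp: chart_differentiable_def o_def)
    show "det (g c (chart_inv c y)) \<noteq> 0" if "y \<in> chart_image c" for y
      using metric_inverse[OF riemannian chart chart_inv_dom[OF that]]
      by (auto simp: invertible_det_nz[symmetric] invertible_def)
  qed
qed

lemma christoffel_differentiable: "chart_differentiable c (christoffel g c k i j)"
proof -
  have "christoffel g c k i j = (\<lambda>p. (\<Sum>l\<in>UNIV. matrix_inv (g c p) $ k $ l *
        (pd c i (\<lambda>q. g c q $ j $ l) p + pd c j (\<lambda>q. g c q $ i $ l) p
           - pd c l (\<lambda>q. g c q $ i $ j) p)) * (1 / 2))"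
    by (simp add: christoffel_def fun_eq_iff)
  then show ?thesis
    by (simp only:) (intro chart_differentiable_mult chart_differentiable_sum chart_differentiable_diff
        chart_differentiable_add chart_differentiable_const metric_differentiable
        inverse_metric_differentiable)
qed

definition gradient :: "('a \<Rightarrow> real) \<Rightarrow> 'n \<Rightarrow> 'a \<Rightarrow> real" where
  "gradient h k p = (\<Sum>l\<in>UNIV. matrix_inv (g c p) $ k $ l * pd c l h p)"

lemma gradient_differentiable:
  assumes "smooth_function A h"
  shows "chart_differentiable c (gradient h k)"
  unfolding gradient_def using assms chart
  by (intro chart_differentiable_sum chart_differentiable_mult inverse_metric_differentiable
      smooth_imp_chart_differentiable) (auto simp: smooth_function_def)

lemma lower_gradient:
  assumes "p \<in> chart_dom c"
  shows "(\<Sum>k\<in>UNIV. g c p $ j $ k * gradient h k p) = pd c j h p"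
proof -
  have "(\<Sum>k\<in>UNIV. g c p $ j $ k * gradient h k p)
      = (\<Sum>l\<in>UNIV. (g c p ** matrix_inv (g c p)) $ j $ l * pd c l h p)"
    by (simp add: gradient_def matrix_matrix_mult_def sum_distrib_left sum_distrib_right mult_ac)
       (rule sum.swap)
  also have "\<dots> = (\<Sum>l\<in>UNIV. if j = l then pd c l h p else 0)"
    by (intro sum.cong) (simp_all add: metric_inverse[OF riemannian chart assms] mat_def)
  finally show ?thesis by simp
qed

text \<open>Equations between vectors may be checked after lowering the index, where the compatibility of the
  connection with the metric can be used.\<close>

lemma metric_cancel:
  assumes p: "p \<in> chart_dom c"
    and "\<And>j. (\<Sum>k\<in>UNIV. g c p $ j $ k * v k) = (\<Sum>k\<in>UNIV. g c p $ j $ k * w k)"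
  shows "v k = w k"
proof -
  have "g c p *v (\<chi> k. v k) = g c p *v (\<chi> k. w k)"
    using assms(2) by (simp add: matrix_vector_mult_def vec_eq_iff)
  then have "(matrix_inv (g c p) ** g c p) *v (\<chi> k. v k) = (matrix_inv (g c p) ** g c p) *v (\<chi> k. w k)"
    by (metis matrix_vector_mul_assoc)
  then show ?thesis
    by (simp add: metric_inverse[OF riemannian chart p] vec_eq_iff)
qed

lemma pd_metric:
  assumes "p \<in> chart_dom c"
  shows "pd c i (\<lambda>q. g c q $ j $ k) p =
    (\<Sum>l\<in>UNIV. christoffel g c l i j p * g c p $ l $ k) + (\<Sum>l\<in>UNIV. christoffel g c l i k p * g c p $ j $ l)"
  using nabla_metric[OF riemannian chart assms, of i j k] by (simp add: nabla2_def)

text \<open>Lowering an index commutes with covariant differentiation since \<open>\<nabla>g = 0\<close>; lowering the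
  covariant derivative of the gradient therefore gives that of \<open>dh\<close>, which is the Hessian.\<close>

lemma nabla_gradient_lower:
  assumes h: "smooth_function A h" and p: "p \<in> chart_dom c"
  shows "(\<Sum>k\<in>UNIV. g c p $ j $ k *
      (pd c i (gradient h k) p + (\<Sum>m\<in>UNIV. christoffel g c k i m p * gradient h m p)))
    = hessian g c h i j p"
proof -
  let ?X = "gradient h" and ?G = "christoffel g c"
  have "pd c i (pd c j h) p = pd c i (\<lambda>q. \<Sum>k\<in>UNIV. g c q $ j $ k * ?X k q) p"
    by (rule pd_cong[OF manifold chart p]) (simp add: lower_gradient)
  also have "\<dots> = (\<Sum>k\<in>UNIV. g c p $ j $ k * pd c i (?X k) p + pd c i (\<lambda>q. g c q $ j $ k) p * ?X k p)"
    by (simp add: pd_sum pd_mult chart_differentiable_mult metric_differentiable gradient_differentiable h p)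
  also have "\<dots> = (\<Sum>k\<in>UNIV. g c p $ j $ k * pd c i (?X k) p)
      + (\<Sum>k\<in>UNIV. \<Sum>l\<in>UNIV. ?G l i j p * (g c p $ l $ k * ?X k p))
      + (\<Sum>k\<in>UNIV. \<Sum>l\<in>UNIV. g c p $ j $ l * (?G l i k p * ?X k p))"
    by (simp add: pd_metric[OF p] sum.distrib distrib_right sum_distrib_right mult.assoc)
       (simp add: mult_ac)
  also have "(\<Sum>k\<in>UNIV. \<Sum>l\<in>UNIV. ?G l i j p * (g c p $ l $ k * ?X k p))
      = (\<Sum>l\<in>UNIV. ?G l i j p * pd c l h p)"
    by (subst sum.swap) (simp add: lower_gradient[OF p] flip: sum_distrib_left)
  also have "(\<Sum>k\<in>UNIV. \<Sum>l\<in>UNIV. g c p $ j $ l * (?G l i k p * ?X k p))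
      = (\<Sum>l\<in>UNIV. g c p $ j $ l * (\<Sum>k\<in>UNIV. ?G l i k p * ?X k p))"
    by (subst sum.swap) (simp add: sum_distrib_left)
  finally show ?thesis
    by (simp add: hessian_def nabla1_def distrib_left sum.distrib)
qed

lemma hessian_conformal_imp_concircular:
  assumes h: "smooth_function A h" and p: "p \<in> chart_dom c"
    and hess: "\<And>i j. hessian g c h i j p = \<kappa> * g c p $ i $ j"
  shows "pd c i (gradient h k) p + (\<Sum>m\<in>UNIV. christoffel g c k i m p * gradient h m p)
    = (if i = k then \<kappa> else 0)"
proof (rule metric_cancel[OF p])
  fix j
  have "(\<Sum>k\<in>UNIV. g c p $ j $ k * (if i = k then \<kappa> else 0)) = \<kappa> * g c p $ i $ j"
    using metric_sym[OF riemannian chart p, of i j] by (simp add: if_distrib cong: if_cong)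
  then show "(\<Sum>k\<in>UNIV. g c p $ j $ k *
      (pd c i (gradient h k) p + (\<Sum>m\<in>UNIV. christoffel g c k i m p * gradient h m p)))
    = (\<Sum>k\<in>UNIV. g c p $ j $ k * (if i = k then \<kappa> else 0))"
    by (simp add: nabla_gradient_lower[OF h p] hess)
qed

lemma ricci_gradient_eq_0:
  assumes h: "smooth_function A h"
    and hess: "\<And>i j p. p \<in> chart_dom c \<Longrightarrow> hessian g c h i j p = \<kappa> * g c p $ i $ j"
    and p: "p \<in> chart_dom c"
  shows "(\<Sum>k\<in>UNIV. ricci g c j k p * gradient h k p) = 0"
  using concircular_ricci[OF manifold_chart_axioms gradient_differentiable[OF h]
      christoffel_differentiable christoffel_sym[OF riemannian chart]
      hessian_conformal_imp_concircular[OF h _ hess] p] .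

section \<open>Steady solitons on static perfect fluids\<close>

text \<open>Substituting the soliton equation into the tracefree fluid equation gives
  \<open>f (S - (r/n) g) = -(S - (r/n) g)\<close>, and \<open>f \<noteq> -1\<close> because \<open>f\<close> is positive.\<close>

lemma spf_soliton_einstein:
  assumes spf: "static_perfect_fluid A g f rho"
    and soliton: "steady_gradient_ricci_soliton A g f"
    and p: "p \<in> chart_dom c"
  shows "laplacian g c f p = - scalar_curvature g c p"
    and "ricci g c i j p = scalar_curvature g c p / real CARD('n) * g c p $ i $ j"
    and "hessian g c f i j p = - (scalar_curvature g c p / real CARD('n)) * g c p $ i $ j"
proof -
  have hess: "hessian g c f i j p = - ricci g c i j p" for i j
  proof -
    have "hessian g c f i j p + ricci g c i j p = 0"
      using soliton chart p by (simp add: gradient_ricci_soliton_def)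
    then show ?thesis by simp
  qed
  show lap: "laplacian g c f p = - scalar_curvature g c p"
    by (simp add: laplacian_def scalar_curvature_def metric_trace_def hess sum_negf)
  have "f p * (ricci g c i j p - scalar_curvature g c p / real CARD('n) * g c p $ i $ j)
      = hessian g c f i j p - laplacian g c f p / real CARD('n) * g c p $ i $ j"
    and f: "f p > 0"
    using spf chart p by (auto simp: static_perfect_fluid_def Let_def)
  then have "(f p + 1) * (ricci g c i j p - scalar_curvature g c p / real CARD('n) * g c p $ i $ j) = 0"
    by (simp add: hess lap algebra_simps add_divide_distrib)
  then show "ricci g c i j p = scalar_curvature g c p / real CARD('n) * g c p $ i $ j"
    using f by simp
  then show "hessian g c f i j p = - (scalar_curvature g c p / real CARD('n)) * g c p $ i $ j"
    by (simp add: hess)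
qed

text \<open>A nonzero \<open>r\<close> would make the Ricci tensor nondegenerate, hence kill the gradient of \<open>f\<close> on the
  whole chart domain; but a function with vanishing differential has Laplacian \<open>0\<close>, not \<open>-r\<close>.\<close>

lemma spf_soliton_scalar_curvature_0:
  assumes spf: "static_perfect_fluid A g f rho"
    and soliton: "steady_gradient_ricci_soliton A g f"
    and const: "\<And>p. p \<in> chart_dom c \<Longrightarrow> scalar_curvature g c p = r"
    and p: "p \<in> chart_dom c"
  shows "r = 0"
proof (rule ccontr)
  assume r: "r \<noteq> 0"
  have f: "smooth_function A f" using spf by (simp add: static_perfect_fluid_def)
  have df: "pd c j f q = 0" if q: "q \<in> chart_dom c" for j q
  proof -
    have "0 = (\<Sum>k\<in>UNIV. ricci g c j k q * gradient f k q)"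
      using ricci_gradient_eq_0[OF f _ q, of "- (r / real CARD('n))"]
        spf_soliton_einstein(3)[OF spf soliton]
      by (simp add: const)
    also have "\<dots> = r / real CARD('n) * pd c j f q"
      unfolding lower_gradient[OF q, symmetric] spf_soliton_einstein(2)[OF spf soliton q] const[OF q]
      by (simp add: sum_distrib_left mult.assoc)
    finally show ?thesis using r by simp
  qed
  have "hessian g c f i j p = 0" for i j
  proof -
    have "pd c i (pd c j f) p = pd c i (\<lambda>q. 0) p"
      by (rule pd_cong[OF manifold chart p df])
    then show ?thesis by (simp add: hessian_def nabla1_def pd_const df p)
  qed
  then have "laplacian g c f p = 0" by (simp add: laplacian_def metric_trace_def)
  then show False using spf_soliton_einstein(1)[OF spf soliton p] const[OF p] r by simp
qed

end

theorem theorem5p4: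
  fixes M :: "'a topology"
    and A :: "('a, 'n::finite) chart set"
    and g :: "('a, 'n) metric"
    and f rho :: "'a \<Rightarrow> real"
  assumes "riemannian_manifold M A g"
    and "CARD('n) \<ge> 2"
    and "static_perfect_fluid A g f rho"
    and "steady_gradient_ricci_soliton A g f"
    and "ricci_symmetric A g"
    and "constant_scalar_curvature A g"
  shows "(\<exists>k. \<forall>p\<in>topspace M. f p = k) \<or> stiff_matter A g rho"
proof -
  obtain r where r: "\<And>c p. c \<in> A \<Longrightarrow> p \<in> chart_dom c \<Longrightarrow> scalar_curvature g c p = r"
    using assms(6) by (auto simp: constant_scalar_curvature_def)
  have "rho p = scalar_curvature g c p / 2" if c: "c \<in> A" and p: "p \<in> chart_dom c" for c p
  proof -
    interpret riemannian_chart M A g c using assms(1) c by unfold_locales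
    have "r = 0" using spf_soliton_scalar_curvature_0[OF assms(3,4) r[OF c] p] .
    then have sc: "scalar_curvature g c p = 0" using r[OF c p] by simp
    let ?n = "real CARD('n)"
    have "laplacian g c f p = ((?n - 2) / (2 * (?n - 1)) * scalar_curvature g c p
        + ?n / (?n - 1) * rho p) * f p" and f: "f p > 0"
      using assms(3) c p by (auto simp: static_perfect_fluid_def Let_def)
    then have "?n / (?n - 1) * rho p = 0"
      using spf_soliton_einstein(1)[OF assms(3,4) p] sc by simp
    moreover have "?n / (?n - 1) \<noteq> 0" using assms(2) by simp
    ultimately show ?thesis using sc by simp
  qed
  then show ?thesis by (simp add: stiff_matter_def)
qed

end
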